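(* Let $A\in\mathbb{R}^{m\times n}$ (all entries finite), let $b\in\mathbb{R}^m$, and let $J=\{1,\dots,n\}$. Then the $\ell_1$-error set function $E$ on subsets of $J$ associated with $(A,b)$ is decreasing and supermodular.
   Context: Let $I=\{1,\dots,m\}$, $J=\{1,\dots,n\}$. The principal solution is $\bar x\in\mathbb{R}^n$, $\bar x_j=\min_{i\in I}(b_i-A_{ij})$. Let $A_j$ denote the $j$-th column of $A$, let $A_j+\bar x_j$ denote the vector with components $A_{ij}+\bar x_j$, and let $\bigvee$ denote the componentwise maximum of vectors. The error vector of $T\subseteq J$ is $$e(T)=b-\bigvee_{j\in T}(A_j+\bar x_j)\ \text{ for } T\neq\emptyset,\qquad e(\emptyset)=\bigvee_{j\in J}e(\{j\}),$$ and the $\ell_1$-error function is $E(T)=\|e(T)\|_1=\sum_{i\in I}|e_i(T)|$. A set function $f:2^J\to\mathbb{R}$ is decreasing if $f(C)\ge f(B)$ for all $C\subseteq B\subseteq J$, and supermodular if $f(C\cup\{k\})-f(C)\le f(B\cup\{k\})-f(B)$ for all $C\subseteq B\subseteq J$ and $k\in J$. *)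

theory Defs
  imports "HOL-Analysis.Analysis"
begin

text \<open>The index sets \<open>I = {1,...,m}\<close> and \<open>J = {1,...,n}\<close> are the finite (nonempty) types
  \<open>'m\<close> and \<open>'n\<close>, so that subsets of \<open>J\<close> are exactly the terms of type \<open>'n set\<close>.\<close>

definition principal_solution :: "real ^ 'n ^ 'm \<Rightarrow> real ^ 'm \<Rightarrow> real ^ 'n" where
  "principal_solution A b = (\<chi> j. Min (range (\<lambda>i. b $ i - A $ i $ j)))"

text \<open>Only used for \<open>T \<noteq> {}\<close>; \<open>Max\<close> of the empty set is unspecified.\<close>

definition vec_Max :: "('j \<Rightarrow> real ^ 'm) \<Rightarrow> 'j set \<Rightarrow> real ^ 'm" where
  "vec_Max v T = (\<chi> i. Max ((\<lambda>j. v j $ i) ` T))"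

definition shifted_column :: "real ^ 'n ^ 'm \<Rightarrow> real ^ 'm \<Rightarrow> 'n \<Rightarrow> real ^ 'm" where
  "shifted_column A b j = (\<chi> i. column j A $ i + principal_solution A b $ j)"

definition nonempty_error :: "real ^ 'n ^ 'm \<Rightarrow> real ^ 'm \<Rightarrow> 'n set \<Rightarrow> real ^ 'm" where
  "nonempty_error A b T = b - vec_Max (shifted_column A b) T"

definition error_vec :: "real ^ 'n ^ 'm \<Rightarrow> real ^ 'm \<Rightarrow> 'n set \<Rightarrow> real ^ 'm" where
  "error_vec A b T =
     (if T = {} then vec_Max (\<lambda>j. nonempty_error A b {j}) UNIV else nonempty_error A b T)"

definition l1_error :: "real ^ 'n ^ 'm \<Rightarrow> real ^ 'm \<Rightarrow> 'n set \<Rightarrow> real" where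
  "l1_error A b T = (\<Sum>i\<in>UNIV. \<bar>error_vec A b T $ i\<bar>)"

definition supermodular :: "('j set \<Rightarrow> real) \<Rightarrow> bool" where
  "supermodular f \<longleftrightarrow>
     (\<forall>B C k. C \<subseteq> B \<longrightarrow> f (C \<union> {k}) - f C \<le> f (B \<union> {k}) - f B)"

end

theory Submission
  imports Defs
begin

text \<open>By the choice of the principal solution, every shifted column lies below \<open>b\<close>, so the gaps
  \<open>d i j\<close> between \<open>b $ i\<close> and the \<open>i\<close>-th entry of the \<open>j\<close>-th shifted column are nonnegative.
  For nonempty \<open>T\<close> the \<open>i\<close>-th entry of the error vector is the minimum of \<open>d i j\<close> over
  \<open>j \<in> T\<close>. The convention for the empty set gives the maximum of \<open>d i j\<close> over all \<open>j\<close>, which is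
  exactly what makes one formula cover both cases: adjoining this largest gap as an extra
  candidate never changes a nonempty minimum (\<open>error_vec_eq_capped_min\<close>).

  Hence the \<open>\<ell>\<^sub>1\<close>-error is the sum over \<open>i\<close> of set functions of the form
  \<open>T \<mapsto> Min ({M} \<union> d ` T)\<close>. Such a function is decreasing, and adding \<open>k\<close> to \<open>T\<close> changes it by
  \<open>min 0 (d k - f T)\<close>, which grows as \<open>f T\<close> decreases, that is, as \<open>T\<close> grows. So it
  is supermodular, and both properties are preserved by sums.\<close>

definition capped_min :: "real \<Rightarrow> ('j \<Rightarrow> real) \<Rightarrow> 'j set \<Rightarrow> real" where
  "capped_min M d T = Min (insert M (d ` T))"

lemma antimono_capped_min:
  fixes d :: "'j::finite \<Rightarrow> real"
  shows "antimono (capped_min M d)"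
  unfolding capped_min_def by (intro antimonoI Min_antimono) auto

lemma capped_min_insert:
  fixes d :: "'j::finite \<Rightarrow> real"
  shows "capped_min M d (insert k T) = min (d k) (capped_min M d T)"
  by (simp add: capped_min_def insert_commute[of M "d k"])

text \<open>The marginal change from adding \<open>k\<close> depends on \<open>T\<close> only through \<open>capped_min M d T\<close>,
  and \<open>v \<mapsto> min (d k) v - v\<close> is a decreasing function, so antitonicity already gives
  supermodularity.\<close>

lemma supermodular_capped_min:
  fixes d :: "'j::finite \<Rightarrow> real"
  shows "supermodular (capped_min M d)"
  unfolding supermodular_def
proof (intro allI impI)
  fix B C :: "'j set" and k
  assume "C \<subseteq> B"
  then have "capped_min M d B \<le> capped_min M d C"
    by (rule antimonoD[OF antimono_capped_min])
  then show "capped_min M d (C \<union> {k}) - capped_min M d C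
      \<le> capped_min M d (B \<union> {k}) - capped_min M d B"
    by (simp add: capped_min_insert)
qed

lemma antimono_sum:
  fixes f :: "'i \<Rightarrow> 'a::order \<Rightarrow> real"
  assumes "\<And>i. i \<in> S \<Longrightarrow> antimono (f i)"
  shows "antimono (\<lambda>T. \<Sum>i\<in>S. f i T)"
  using assms by (intro antimonoI sum_mono) (auto dest: antimonoD)

lemma supermodular_sum:
  assumes "\<And>i. i \<in> S \<Longrightarrow> supermodular (f i)"
  shows "supermodular (\<lambda>T. \<Sum>i\<in>S. f i T)"
  unfolding supermodular_def sum_subtractf[symmetric]
  using assms by (intro allI impI sum_mono) (simp add: supermodular_def)

definition gap :: "real ^ 'n ^ 'm \<Rightarrow> real ^ 'm \<Rightarrow> 'm \<Rightarrow> 'n \<Rightarrow> real" where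
  "gap A b i j = b $ i - shifted_column A b j $ i"

text \<open>The \<open>j\<close>-th entry of the principal solution is a minimum of differences, one of which is
  \<open>b $ i - A $ i $ j\<close>.\<close>

lemma gap_nonneg: "0 \<le> gap A b i j"
proof -
  have "principal_solution A b $ j \<le> b $ i - A $ i $ j"
    by (simp add: principal_solution_def)
  then show ?thesis
    by (simp add: gap_def shifted_column_def column_def)
qed

lemma nonempty_error_eq_Min_gap:
  assumes "T \<noteq> {}"
  shows "nonempty_error A b T $ i = Min (gap A b i ` T)"
proof -
  define s where "s j = shifted_column A b j $ i" for j
  have "Min ((\<lambda>j. b $ i - s j) ` T) = b $ i - Max (s ` T)"
  proof (rule Min_eqI)
    have "Max (s ` T) \<in> s ` T"
      using assms by (intro Max_in) auto
    then show "b $ i - Max (s ` T) \<in> (\<lambda>j. b $ i - s j) ` T"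
      by auto
  qed auto
  then show ?thesis
    by (simp add: nonempty_error_def vec_Max_def s_def gap_def)
qed

text \<open>The value prescribed at the empty set is the largest gap, so it serves as the cap; for
  nonempty \<open>T\<close> the cap is harmless because some gap over \<open>T\<close> is already at most the largest one.\<close>

lemma error_vec_eq_capped_min:
  "error_vec A b T $ i = capped_min (Max (range (gap A b i))) (gap A b i) T"
proof (cases "T = {}")
  case True
  then show ?thesis
    by (simp add: error_vec_def vec_Max_def nonempty_error_eq_Min_gap capped_min_def)
next
  case False
  then obtain j where "j \<in> T" by blast
  then have "Min (gap A b i ` T) \<le> gap A b i j"
    by simp
  also have "\<dots> \<le> Max (range (gap A b i))"
    by simp
  finally show ?thesis
    using False by (simp add: error_vec_def nonempty_error_eq_Min_gap capped_min_def min_absorb2)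
qed

lemma error_vec_nonneg: "0 \<le> error_vec A b T $ i"
proof -
  have "0 \<le> Max (range (gap A b i))"
    using gap_nonneg[of A b i undefined] by (rule order_trans) simp
  then show ?thesis
    by (simp add: error_vec_eq_capped_min capped_min_def gap_nonneg)
qed

lemma l1_error_eq_sum_capped_min:
  "l1_error A b = (\<lambda>T. \<Sum>i\<in>UNIV. capped_min (Max (range (gap A b i))) (gap A b i) T)"
  by (rule ext) (simp add: l1_error_def error_vec_nonneg flip: error_vec_eq_capped_min)

theorem theorem3:
  fixes A :: "real ^ 'n ^ 'm" and b :: "real ^ 'm"
  shows "antimono (l1_error A b) \<and> supermodular (l1_error A b)"
  unfolding l1_error_eq_sum_capped_min
  by (intro conjI antimono_sum supermodular_sum antimono_capped_min supermodular_capped_min)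

end
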